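(* Let $X$ be a complex Banach space and let $T\in B(X)$ be a power-bounded operator, i.e. $T$ is invertible and $\sup_{n\in\mathbb{Z}}\|T^n\|<\infty$. Suppose that the spectrum of $T$ is a finite set $\sigma(T)=\{\lambda_1,\lambda_2,\dots,\lambda_m\}$ with $\lambda_1,\dots,\lambda_m$ pairwise distinct. Then $T$ is an algebraic operator such that $\prod_{j=1}^m(T-\lambda_jI)=0$.
   Context: $B(X)$ is the algebra of all bounded complex linear operators on the complex Banach space $X$, $I$ is the identity operator on $X$, and $\sigma(T)$ is the spectrum of $T\in B(X)$. Here "power-bounded" is two-sided: $T$ is an invertible bounded operator and the supremum of $\|T^n\|$ is taken over all integers $n$. An operator $T$ is algebraic if $p(T)=0$ for some nonzero complex polynomial $p$. *)

theory Defs
  imports "HOL-Analysis.Analysis" "HOL-Computational_Algebra.Polynomial"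
begin

text \<open>The complex scaling extends the given real one, so the real-linear library applies unchanged.\<close>

class scaleC = scaleR +
  fixes scaleC :: "complex \<Rightarrow> 'a \<Rightarrow> 'a" (infixr \<open>*\<^sub>C\<close> 75)
  assumes scaleR_scaleC: "r *\<^sub>R x = complex_of_real r *\<^sub>C x"

class complex_normed_vector = scaleC + real_normed_vector +
  assumes scaleC_add_right: "a *\<^sub>C (x + y) = a *\<^sub>C x + a *\<^sub>C y"
    and scaleC_add_left: "(a + b) *\<^sub>C x = a *\<^sub>C x + b *\<^sub>C x"
    and scaleC_scaleC: "a *\<^sub>C (b *\<^sub>C x) = (a * b) *\<^sub>C x"
    and scaleC_one: "1 *\<^sub>C x = x"
    and norm_scaleC: "norm (a *\<^sub>C x) = cmod a * norm x"

class complex_banach = complex_normed_vector + banach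

lemma bounded_linear_scaleC:
  "bounded_linear (\<lambda>x::'a::complex_normed_vector. a *\<^sub>C x)"
  by (rule bounded_linear_intro[where K = "cmod a"])
    (simp_all add: scaleC_add_right scaleR_scaleC scaleC_scaleC norm_scaleC mult.commute)

instantiation blinfun :: (real_normed_vector, complex_normed_vector) complex_normed_vector
begin

lift_definition scaleC_blinfun :: "complex \<Rightarrow> ('a \<Rightarrow>\<^sub>L 'b) \<Rightarrow> ('a \<Rightarrow>\<^sub>L 'b)"
  is "\<lambda>a f x. a *\<^sub>C f x"
  by (rule bounded_linear_compose[OF bounded_linear_scaleC])

instance
proof
  fix a b :: complex and r :: real and f g :: "'a \<Rightarrow>\<^sub>L 'b"
  show "r *\<^sub>R f = complex_of_real r *\<^sub>C f"
    by transfer (simp add: scaleR_scaleC)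
  show "a *\<^sub>C (f + g) = a *\<^sub>C f + a *\<^sub>C g"
    by transfer (simp add: scaleC_add_right)
  show "(a + b) *\<^sub>C f = a *\<^sub>C f + b *\<^sub>C f"
    by transfer (simp add: scaleC_add_left)
  show "a *\<^sub>C (b *\<^sub>C f) = (a * b) *\<^sub>C f"
    by transfer (simp add: scaleC_scaleC)
  show "1 *\<^sub>C f = f"
    by transfer (simp add: scaleC_one)
  have le: "norm (c *\<^sub>C h) \<le> cmod c * norm h" for c :: complex and h :: "'a \<Rightarrow>\<^sub>L 'b"
  proof (rule norm_blinfun_bound)
    fix x
    have "cmod c * norm (blinfun_apply h x) \<le> cmod c * (norm h * norm x)"
      by (intro mult_left_mono norm_blinfun) simp
    then show "norm (blinfun_apply (c *\<^sub>C h) x) \<le> cmod c * norm h * norm x"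
      by (simp add: scaleC_blinfun.rep_eq norm_scaleC mult.assoc)
  qed simp
  show "norm (a *\<^sub>C f) = cmod a * norm f"
  proof (cases "a = 0")
    case True
    then show ?thesis using le[of 0 f] by simp
  next
    case False
    have "f = inverse a *\<^sub>C (a *\<^sub>C f)"
      using False by transfer (simp add: scaleC_scaleC scaleC_one)
    then have "norm f \<le> cmod (inverse a) * norm (a *\<^sub>C f)"
      using le[of "inverse a" "a *\<^sub>C f"] by simp
    then have "cmod a * norm f \<le> norm (a *\<^sub>C f)"
      using False by (simp add: norm_divide field_simps)
    then show ?thesis using le[of a f] by simp
  qed
qed

end

text \<open>The type of bounded linear functions only records real linearity, so the algebra
  \<open>B(X)\<close> is its subset of complex linear elements. The norm is the operator norm in both.\<close>

definition bounded_ops :: "('a::complex_normed_vector \<Rightarrow>\<^sub>L 'a) set" where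
  "bounded_ops = {T. \<forall>a x. blinfun_apply T (a *\<^sub>C x) = a *\<^sub>C blinfun_apply T x}"

definition is_op_inverse ::
  "('a::complex_normed_vector \<Rightarrow>\<^sub>L 'a) \<Rightarrow> ('a \<Rightarrow>\<^sub>L 'a) \<Rightarrow> bool" where
  "is_op_inverse T S \<longleftrightarrow>
     S \<in> bounded_ops \<and> S o\<^sub>L T = id_blinfun \<and> T o\<^sub>L S = id_blinfun"

definition op_invertible :: "('a::complex_normed_vector \<Rightarrow>\<^sub>L 'a) \<Rightarrow> bool" where
  "op_invertible T \<longleftrightarrow> (\<exists>S. is_op_inverse T S)"

text \<open>Unspecified unless the operator is invertible; two-sided inverses are unique.\<close>

definition op_inverse :: "('a::complex_normed_vector \<Rightarrow>\<^sub>L 'a) \<Rightarrow> ('a \<Rightarrow>\<^sub>L 'a)" where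
  "op_inverse T = (THE S. is_op_inverse T S)"

primrec op_power :: "('a::complex_normed_vector \<Rightarrow>\<^sub>L 'a) \<Rightarrow> nat \<Rightarrow> ('a \<Rightarrow>\<^sub>L 'a)" where
  "op_power T 0 = id_blinfun"
| "op_power T (Suc n) = T o\<^sub>L op_power T n"

definition op_power_int :: "('a::complex_normed_vector \<Rightarrow>\<^sub>L 'a) \<Rightarrow> int \<Rightarrow> ('a \<Rightarrow>\<^sub>L 'a)" where
  "op_power_int T n =
     (if n \<ge> 0 then op_power T (nat n) else op_power (op_inverse T) (nat (- n)))"

definition power_bounded :: "('a::complex_normed_vector \<Rightarrow>\<^sub>L 'a) \<Rightarrow> bool" where
  "power_bounded T \<longleftrightarrow>
     op_invertible T \<and> bdd_above (range (\<lambda>n::int. norm (op_power_int T n)))"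

definition op_spectrum :: "('a::complex_normed_vector \<Rightarrow>\<^sub>L 'a) \<Rightarrow> complex set" where
  "op_spectrum T = {z. \<not> op_invertible (T - z *\<^sub>C id_blinfun)}"

definition poly_op :: "complex poly \<Rightarrow> ('a::complex_normed_vector \<Rightarrow>\<^sub>L 'a) \<Rightarrow> ('a \<Rightarrow>\<^sub>L 'a)" where
  "poly_op p T = (\<Sum>i\<le>degree p. coeff p i *\<^sub>C op_power T i)"

definition algebraic_op :: "('a::complex_normed_vector \<Rightarrow>\<^sub>L 'a) \<Rightarrow> bool" where
  "algebraic_op T \<longleftrightarrow> (\<exists>p. p \<noteq> 0 \<and> poly_op p T = 0)"

text \<open>Composition is not a commutative monoid, so products of operators are taken over lists,
  with the head of the list as the leftmost factor.\<close>

definition op_prod_list :: "('a::complex_normed_vector \<Rightarrow>\<^sub>L 'a) list \<Rightarrow> ('a \<Rightarrow>\<^sub>L 'a)" where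
  "op_prod_list Ts = foldr (o\<^sub>L) Ts id_blinfun"

end

theory Submission
  imports Defs "HOL-Complex_Analysis.Residue_Theorem"
begin

text \<open>Power-boundedness bounds the resolvent \<open>R(z) = (T - z)\<^sup>-\<^sup>1\<close> by \<open>C / \<bar>\<bar>z\<bar> - 1\<bar>\<close>. At an isolated
  spectral point \<open>\<zeta>\<close> on the unit circle this leaves room for a simple pole only: on the circle of
  radius \<open>\<rho>\<close> about \<open>\<zeta>\<close>, the quadratic polynomial vanishing at the two points of the unit circle
  cancels the singularity of the bound. Let \<open>P\<close> be the product of the \<open>T - \<lambda>\<^sub>j\<close>, each factor of which
  removes one such pole, and let \<open>f\<close> be a bounded functional. Then \<open>f (P R(z))\<close> has zero residues at
  all spectral points, so by the residue theorem on large circles its leading coefficient at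
  infinity, \<open>- f P\<close>, vanishes. As functionals separate points (by the Hahn-Banach theorem), \<open>P = 0\<close>.\<close>

section \<open>Bounded linear functionals\<close>

definition sublinear :: "('a::real_vector \<Rightarrow> real) \<Rightarrow> bool" where
  "sublinear p \<longleftrightarrow> (\<forall>x y. p (x + y) \<le> p x + p y) \<and> (\<forall>c x. 0 \<le> c \<longrightarrow> p (c *\<^sub>R x) = c * p x)"

lemma sublinear_add: "sublinear p \<Longrightarrow> p (x + y) \<le> p x + p y"
  and sublinear_scale: "sublinear p \<Longrightarrow> 0 \<le> c \<Longrightarrow> p (c *\<^sub>R x) = c * p x"
  by (auto simp: sublinear_def)

lemma sublinear_zero: "sublinear p \<Longrightarrow> p 0 = 0"
  using sublinear_scale[of p 0 0] by simp

lemma sublinear_minus: "sublinear p \<Longrightarrow> - p (- x) \<le> p x"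
  using sublinear_add[of p x "- x"] sublinear_zero[of p] by simp

lemma sublinear_norm: "sublinear norm"
  by (simp add: sublinear_def norm_triangle_ineq)

text \<open>The hypotheses ask only for some member of the family below a given sum or multiple.
  This covers both the one-parameter family of \<open>sublinear_decrease\<close> and the chains in
  Zorn's lemma.\<close>

lemma sublinear_Inf:
  fixes P :: "('a::real_vector \<Rightarrow> real) set"
  assumes "P \<noteq> {}"
    and bdd: "\<And>x. bdd_below ((\<lambda>p. p x) ` P)"
    and add: "\<And>p q x y. p \<in> P \<Longrightarrow> q \<in> P \<Longrightarrow> \<exists>r\<in>P. r (x + y) \<le> p x + q y"
    and scale: "\<And>p c x. p \<in> P \<Longrightarrow> 0 < c \<Longrightarrow> \<exists>r\<in>P. r (c *\<^sub>R x) \<le> c * p x"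
    and zero: "\<And>p. p \<in> P \<Longrightarrow> p 0 = 0"
  shows "sublinear (\<lambda>x. INF p\<in>P. p x)"
proof -
  let ?g = "\<lambda>x. INF p\<in>P. p x"
  have lower: "?g x \<le> p x" if "p \<in> P" for p x
    using that bdd by (rule cINF_lower[rotated])
  have "?g (x + y) \<le> ?g x + ?g y" for x y
  proof -
    have "?g (x + y) - p x \<le> ?g y" if p: "p \<in> P" for p
    proof (rule cINF_greatest[OF assms(1)])
      fix q assume "q \<in> P"
      then obtain r where "r \<in> P" "r (x + y) \<le> p x + q y"
        using add p by blast
      with lower[of r "x + y"] show "?g (x + y) - p x \<le> q y" by simp
    qed
    then have "?g (x + y) - ?g y \<le> ?g x"
      by (intro cINF_greatest[OF assms(1)]) (simp add: algebra_simps)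
    then show ?thesis by simp
  qed
  moreover have "?g (c *\<^sub>R x) = c * ?g x" if "0 \<le> c" for c x
  proof (cases "c = 0")
    case True
    have "?g 0 = (INF p\<in>P. 0)" by (intro INF_cong refl zero)
    then show ?thesis using True assms(1) by simp
  next
    case False
    have le: "?g (d *\<^sub>R z) \<le> d * ?g z" if d: "0 < d" for d z
    proof -
      have "?g (d *\<^sub>R z) / d \<le> ?g z"
      proof (rule cINF_greatest[OF assms(1)])
        fix p assume "p \<in> P"
        then obtain r where "r \<in> P" "r (d *\<^sub>R z) \<le> d * p z"
          using scale d by blast
        with lower[of r "d *\<^sub>R z"] show "?g (d *\<^sub>R z) / d \<le> p z"
          using d by (simp add: field_simps)
      qed
      then show ?thesis using d by (simp add: field_simps)
    qed
    \<comment> \<open>The opposite inequality is \<open>le\<close> for the factor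
      \<open>inverse c\<close> and the vector \<open>c *\<^sub>R x\<close>.\<close>
    have "?g (inverse c *\<^sub>R (c *\<^sub>R x)) \<le> inverse c * ?g (c *\<^sub>R x)"
      using that False by (intro le) simp
    then have "c * ?g x \<le> ?g (c *\<^sub>R x)"
      using that False by (simp add: field_simps)
    with le[of c x] that False show ?thesis by simp
  qed
  ultimately show ?thesis by (simp add: sublinear_def)
qed

text \<open>The decreased functional is \<open>q x = inf\<^sub>t (p (x + t y) - t p y)\<close> over \<open>t \<ge> 0\<close>. A minimal
  sublinear \<open>p\<close> equals its own decrease, which makes it superadditive and hence linear.\<close>

lemma sublinear_decrease:
  fixes p :: "'a::real_vector \<Rightarrow> real"
  assumes p: "sublinear p"
  obtains q where "sublinear q" "\<And>x. q x \<le> p x" "\<And>x. q x \<le> p (x + y) - p y"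
proof -
  let ?f = "\<lambda>t x. p (x + t *\<^sub>R y) - t * p y"
  define P where "P = ?f ` {0..}"
  define q where "q = (\<lambda>x. INF f\<in>P. f x)"
  have ne: "P \<noteq> {}" by (auto simp: P_def)
  \<comment> \<open>Subadditivity for \<open>t y = (x + t y) + (- x)\<close> gives a lower bound
    independent of \<open>t\<close>, so the infimum is finite.\<close>
  have lb: "- p (- x) \<le> ?f t x" if "0 \<le> t" for t x
    using sublinear_add[OF p, of "x + t *\<^sub>R y" "- x"] sublinear_scale[OF p that, of y] by simp
  have bdd: "bdd_below ((\<lambda>f. f x) ` P)" for x
    by (rule bdd_belowI[where m = "- p (- x)"]) (auto simp: P_def lb)
  have "sublinear q"
    unfolding q_def
  proof (rule sublinear_Inf[OF ne bdd])
    fix f g x z assume "f \<in> P" "g \<in> P"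
    then obtain s t where st: "0 \<le> s" "0 \<le> t" "f = ?f s" "g = ?f t"
      by (auto simp: P_def)
    have "?f (s + t) (x + z) \<le> f x + g z"
      using sublinear_add[OF p, of "x + s *\<^sub>R y" "z + t *\<^sub>R y"]
      by (simp add: st algebra_simps)
    moreover have "?f (s + t) \<in> P" using st by (auto simp: P_def)
    ultimately show "\<exists>r\<in>P. r (x + z) \<le> f x + g z" by (rule_tac bexI)
  next
    fix f x and c :: real assume "f \<in> P" "0 < c"
    then obtain t where t: "0 \<le> t" "f = ?f t" by (auto simp: P_def)
    have "?f (c * t) (c *\<^sub>R x) = c * f x"
      using sublinear_scale[OF p, of c "x + t *\<^sub>R y"] \<open>0 < c\<close>
      by (simp add: t algebra_simps)
    moreover have "?f (c * t) \<in> P" using t \<open>0 < c\<close> by (auto simp: P_def)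
    ultimately show "\<exists>r\<in>P. r (c *\<^sub>R x) \<le> c * f x" by (metis order_refl)
  next
    fix f assume "f \<in> P"
    then show "f 0 = 0" by (auto simp: P_def sublinear_scale[OF p])
  qed
  \<comment> \<open>The parameters \<open>t = 0\<close> and \<open>t = 1\<close> give the two
    required bounds.\<close>
  moreover have "q x \<le> ?f t x" if "0 \<le> t" for t x
    unfolding q_def using that by (intro cINF_lower[OF bdd]) (auto simp: P_def)
  from this[of 0] this[of 1] have "q x \<le> p x" "q x \<le> p (x + y) - p y" for x by auto
  ultimately show ?thesis using that by blast
qed

lemma linear_if_minimal_sublinear:
  fixes p :: "'a::real_vector \<Rightarrow> real"
  assumes p: "sublinear p"
    and min: "\<And>q. sublinear q \<Longrightarrow> (\<And>x. q x \<le> p x) \<Longrightarrow> q = p"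
  shows "linear p"
proof -
  have add: "p (x + y) = p x + p y" for x y
  proof -
    obtain q where "sublinear q" "\<And>x. q x \<le> p x" "\<And>x. q x \<le> p (x + y) - p y"
      using sublinear_decrease[OF p] by blast
    with min have "p x \<le> p (x + y) - p y" by metis
    with sublinear_add[OF p, of x y] show ?thesis by simp
  qed
  have neg: "p (- x) = - p x" for x
    using add[of x "- x"] sublinear_zero[OF p] by simp
  have "p (c *\<^sub>R x) = c *\<^sub>R p x" for c x
  proof (cases "0 \<le> c")
    case False
    then have "p ((- c) *\<^sub>R x) = (- c) * p x" by (intro sublinear_scale[OF p]) simp
    then show ?thesis using neg[of "c *\<^sub>R x"] by simp
  qed (simp add: sublinear_scale[OF p])
  with add show ?thesis by (rule linearI)
qed

text \<open>Hahn-Banach without a subspace to extend from: Zorn's lemma yields a minimal sublinear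
  functional below \<open>p\<close>, and minimal ones are linear.\<close>

lemma exists_linear_le_sublinear:
  fixes p :: "'a::real_vector \<Rightarrow> real"
  assumes p: "sublinear p"
  obtains f where "linear f" "\<And>x. f x \<le> p x"
proof -
  define A where "A = {q. sublinear q \<and> (\<forall>x. q x \<le> p x)}"
  \<comment> \<open>The order is reversed, so the maximal elements of Zorn's lemma are minimal
    functionals, and a nonempty chain is bounded by its pointwise infimum.\<close>
  let ?R = "\<lambda>f g :: 'a \<Rightarrow> real. \<forall>x. g x \<le> f x"
  have "\<exists>m\<in>A. \<forall>a\<in>A. ?R m a \<longrightarrow> a = m"
  proof (rule predicate_Zorn)
    show "partial_order_on A (relation_of ?R A)"
      by (rule partial_order_on_relation_ofI) (auto intro: order_trans intro!: order_antisym le_funI)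
  next
    fix C assume C: "C \<in> Chains (relation_of ?R A)"
    have CA: "C \<subseteq> A" using C by (auto simp: Chains_def relation_of_def)
    have tot: "(\<forall>x. g x \<le> f x) \<or> (\<forall>x. f x \<le> g x)" if "f \<in> C" "g \<in> C" for f g
      using C that by (auto simp: Chains_def relation_of_def)
    show "\<exists>u\<in>A. \<forall>a\<in>C. ?R a u"
    proof (cases "C = {}")
      case True
      then show ?thesis using p by (auto simp: A_def)
    next
      case False
      have sub: "sublinear q" "q x \<le> p x" if "q \<in> C" for q x
        using that CA by (auto simp: A_def)
      \<comment> \<open>Each \<open>q\<close> in the chain satisfies
        \<open>- p (- x) \<le> - q (- x) \<le> q x\<close>, and the first term depends on
        \<open>p\<close> alone.\<close>
      have bdd: "bdd_below ((\<lambda>q. q x) ` C)" for x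
      proof (rule bdd_belowI)
        fix r assume "r \<in> (\<lambda>q. q x) ` C"
        then obtain q where "q \<in> C" "r = q x" by auto
        then show "- p (- x) \<le> r"
          using sublinear_minus[of q x] sub(1)[of q] sub(2)[of q "- x"] by simp
      qed
      define u where "u = (\<lambda>x. INF q\<in>C. q x)"
      have "sublinear u"
        unfolding u_def
      proof (rule sublinear_Inf[OF False bdd])
        fix f g x y assume fg: "f \<in> C" "g \<in> C"
        \<comment> \<open>The smaller of the two comparable functionals serves as
          \<open>r\<close>.\<close>
        show "\<exists>r\<in>C. r (x + y) \<le> f x + g y"
          using tot[OF fg]
        proof
          assume *: "\<forall>x. g x \<le> f x"
          have "g (x + y) \<le> f x + g y"
            using sublinear_add[OF sub(1)[OF fg(2)], of x y] *[rule_format, of x] by simp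
          with fg show ?thesis by blast
        next
          assume *: "\<forall>x. f x \<le> g x"
          have "f (x + y) \<le> f x + g y"
            using sublinear_add[OF sub(1)[OF fg(1)], of x y] *[rule_format, of y] by simp
          with fg show ?thesis by blast
        qed
      next
        fix f x and c :: real assume "f \<in> C" "0 < c"
        then show "\<exists>r\<in>C. r (c *\<^sub>R x) \<le> c * f x"
          using sublinear_scale[OF sub(1), of f c x] by (intro bexI[of _ f]) auto
      qed (simp add: sub sublinear_zero)
      moreover have le: "u x \<le> q x" if "q \<in> C" for q x
        unfolding u_def using that by (rule cINF_lower[OF bdd])
      moreover have "u x \<le> p x" for x
        using False le sub(2) by (meson all_not_in_conv order_trans)
      ultimately show ?thesis by (auto simp: A_def)
    qed
  qed
  then obtain m where m: "m \<in> A" "\<And>a. a \<in> A \<Longrightarrow> \<forall>x. a x \<le> m x \<Longrightarrow> a = m" by blast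
  have "linear m"
  proof (rule linear_if_minimal_sublinear)
    fix q assume "sublinear q" "\<And>x. q x \<le> m x"
    with m show "q = m" by (auto simp: A_def intro: order_trans)
  qed (use m in \<open>simp add: A_def\<close>)
  with m(1) show ?thesis using that by (auto simp: A_def)
qed

text \<open>Instead of extending from the line through \<open>x0\<close>, the norm is first
  decreased in the direction \<open>x0\<close>. Every linear functional below the result is at most
  \<open>- norm x0\<close> at \<open>- x0\<close>, hence nonzero at \<open>x0\<close>.\<close>

lemma exists_bounded_linear_functional:
  fixes x0 :: "'a::real_normed_vector"
  assumes "x0 \<noteq> 0"
  obtains f :: "'a \<Rightarrow> real" where "bounded_linear f" "f x0 \<noteq> 0"
proof -
  obtain q :: "'a \<Rightarrow> real" where q: "sublinear q" "\<And>x. q x \<le> norm x"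
    "\<And>x. q x \<le> norm (x + x0) - norm x0"
    using sublinear_decrease[OF sublinear_norm] by blast
  obtain f where f: "linear f" "\<And>x. f x \<le> q x"
    using exists_linear_le_sublinear[OF q(1)] by blast
  have le: "f x \<le> norm x" for x using f(2) q(2) order_trans by blast
  have "norm (f x) \<le> norm x * 1" for x
    using le[of x] le[of "- x"] linear_neg[OF f(1), of x] by simp
  then have "bounded_linear f"
    using f(1) by (intro bounded_linear_intro[where K = 1]) (auto simp: linear_add linear_scale)
  moreover have "f (- x0) \<le> - norm x0"
    using f(2)[of "- x0"] q(3)[of "- x0"] by simp
  then have "f x0 \<noteq> 0"
    using assms linear_neg[OF f(1), of x0] by (auto simp: linear_0)
  ultimately show ?thesis using that by blast
qed

text \<open>A real functional \<open>g\<close> is the real part of the complex linear functional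
  \<open>g x - \<i> g (\<i> x)\<close>, so nonvanishing at \<open>x0\<close> carries over.\<close>

lemma exists_bounded_complex_functional:
  fixes x0 :: "'a::complex_normed_vector"
  assumes "x0 \<noteq> 0"
  obtains f :: "'a \<Rightarrow> complex"
  where "bounded_linear f" "\<And>c x. f (c *\<^sub>C x) = c * f x" "f x0 \<noteq> 0"
proof -
  obtain g :: "'a \<Rightarrow> real" where g: "bounded_linear g" "g x0 \<noteq> 0"
    using exists_bounded_linear_functional[OF assms] by blast
  interpret g: bounded_linear g by fact
  define f where "f = (\<lambda>x. complex_of_real (g x) - \<i> * complex_of_real (g (\<i> *\<^sub>C x)))"
  have "bounded_linear f"
    unfolding f_def
    by (intro bounded_linear_sub bounded_linear_const_mult
        bounded_linear_compose[OF bounded_linear_of_real] g(1)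
        bounded_linear_compose[OF g(1)] bounded_linear_scaleC)
  moreover have "f (c *\<^sub>C x) = c * f x" for c x
  proof -
    \<comment> \<open>Splitting the scalar into real and imaginary parts needs only real linearity
      of \<open>g\<close>; the instances \<open>c\<close> and \<open>\<i> * c\<close> treat the two
      terms of \<open>f (c x)\<close>.\<close>
    have re: "g (c *\<^sub>C x) = Re c * g x + Im c * g (\<i> *\<^sub>C x)" for c x
    proof -
      have "c *\<^sub>C x = Re c *\<^sub>R x + Im c *\<^sub>R (\<i> *\<^sub>C x)"
        by (simp add: scaleR_scaleC scaleC_scaleC flip: scaleC_add_left)
          (metis complex_eq mult.commute)
      then show ?thesis by (simp add: g.add g.scaleR)
    qed
    show ?thesis
      by (simp add: f_def re[of c] re[of "\<i> * c"] scaleC_scaleC complex_eq_iff)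
  qed
  moreover have "Re (f x0) \<noteq> 0" using g(2) by (simp add: f_def)
  then have "f x0 \<noteq> 0" by auto
  ultimately show ?thesis using that by blast
qed

section \<open>Residues and boundary growth\<close>

text \<open>Writing \<open>z = \<zeta> + w\<close> with \<open>cnj w * w = \<rho>\<^sup>2\<close>, the polynomial equals
  \<open>\<zeta> w (\<bar>z\<bar>\<^sup>2 - 1)\<close>: its zeros are the two points where the small circle meets the unit circle.\<close>

lemma cmod_unit_circle_intersection_poly:
  assumes "cmod \<zeta> = 1" "cmod (z - \<zeta>) = \<rho>"
  shows "cmod ((z - \<zeta>)\<^sup>2 + complex_of_real (\<rho>\<^sup>2) * \<zeta> * (z - \<zeta>) + complex_of_real (\<rho>\<^sup>2) * \<zeta>\<^sup>2)
    = \<rho> * \<bar>(cmod z)\<^sup>2 - 1\<bar>"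
proof -
  define w where "w = z - \<zeta>"
  have z: "z = \<zeta> + w" by (simp add: w_def)
  have r: "complex_of_real (\<rho>\<^sup>2) = w * cnj w"
    using assms(2) complex_norm_square[of w] by (simp add: w_def)
  have l: "\<zeta> * cnj \<zeta> = 1"
    using assms(1) complex_norm_square[of \<zeta>] by simp
  have "complex_of_real ((cmod z)\<^sup>2 - 1) = \<zeta> * cnj w + w * cnj \<zeta> + w * cnj w"
    by (simp add: complex_norm_square z algebra_simps l del: of_real_power)
  then have "w\<^sup>2 + w * cnj w * \<zeta> * w + w * cnj w * \<zeta>\<^sup>2
      = w * \<zeta> * complex_of_real ((cmod z)\<^sup>2 - 1)"
    using l by (simp only:) algebra
  then have "cmod (w\<^sup>2 + w * cnj w * \<zeta> * w + w * cnj w * \<zeta>\<^sup>2) = \<rho> * \<bar>(cmod z)\<^sup>2 - 1\<bar>"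
    using assms by (simp add: norm_mult flip: w_def del: of_real_diff)
  then show ?thesis by (simp only: r flip: w_def)
qed

text \<open>If \<zeta> lies on the unit circle, the function \<open>k z / (z - \<zeta>)\<close>
  times the quadratic of the preceding lemma is bounded by \<open>3 * C\<close> on the circle of
  radius \<rho>, so its integral is O(\<rho>). That integral combines three residues, two of them
  with coefficients of order \<rho>^2, so letting \<rho> tend to 0 isolates the third. Off the unit
  circle \<open>k\<close> is bounded near \<zeta>.\<close>

lemma residue_times_diff_eq_0:
  assumes e: "0 < e" and holo: "k holomorphic_on ball \<zeta> e - {\<zeta>}"
    and bound: "\<And>z. z \<in> ball \<zeta> e - {\<zeta>} \<Longrightarrow> cmod (k z) * \<bar>cmod z - 1\<bar> \<le> C"
  shows "residue (\<lambda>z. (z - \<zeta>) * k z) \<zeta> = 0"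
proof (cases "cmod \<zeta> = 1")
  case True
  let ?r2 = "residue (\<lambda>z. (z - \<zeta>) * k z) \<zeta>" and ?r1 = "residue k \<zeta>"
    and ?r0 = "residue (\<lambda>z. k z / (z - \<zeta>)) \<zeta>"
  have est: "cmod (?r2 + complex_of_real (\<rho>\<^sup>2) * \<zeta> * ?r1 + complex_of_real (\<rho>\<^sup>2) * \<zeta>\<^sup>2 * ?r0)
      \<le> 3 * C * \<rho>" if \<rho>: "0 < \<rho>" "\<rho> < e" "\<rho> < 1" for \<rho>
  proof -
    \<comment> \<open>\<open>?F\<close> is \<open>?Q z * (k z / (z - \<zeta>))\<close> expanded,
      with leading term \<open>(z - \<zeta>) * k z\<close>. Dividing by \<open>z - \<zeta>\<close>
      removes the factor \<rho> from the modulus of \<open>?Q\<close>.\<close>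
    let ?Q = "\<lambda>z. (z - \<zeta>)\<^sup>2 + complex_of_real (\<rho>\<^sup>2) * \<zeta> * (z - \<zeta>) + complex_of_real (\<rho>\<^sup>2) * \<zeta>\<^sup>2"
    let ?F = "\<lambda>z. (z - \<zeta>) * k z + complex_of_real (\<rho>\<^sup>2) * \<zeta> * k z
      + complex_of_real (\<rho>\<^sup>2) * \<zeta>\<^sup>2 * (k z / (z - \<zeta>))"
    have base: "(f has_contour_integral 2 * pi * \<i> * residue f \<zeta>) (circlepath \<zeta> \<rho>)"
      if "f holomorphic_on ball \<zeta> e - {\<zeta>}" for f
      using that \<rho> e by (intro base_residue[of "ball \<zeta> e"]) auto
    have "(?F has_contour_integral 2 * pi * \<i> * ?r2
        + complex_of_real (\<rho>\<^sup>2) * \<zeta> * (2 * pi * \<i> * ?r1)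
        + complex_of_real (\<rho>\<^sup>2) * \<zeta>\<^sup>2 * (2 * pi * \<i> * ?r0)) (circlepath \<zeta> \<rho>)"
      by (intro has_contour_integral_add has_contour_integral_lmul base)
        (auto intro!: holomorphic_intros holo)
    moreover have "cmod (?F z) \<le> 3 * C" if z: "cmod (z - \<zeta>) = \<rho>" for z
    proof -
      have zb: "z \<in> ball \<zeta> e - {\<zeta>}"
        using z \<rho> by (auto simp: dist_norm norm_minus_commute)
      have "?F z = ?Q z * (k z / (z - \<zeta>))"
        using zb by (simp add: field_simps power2_eq_square)
      then have "cmod (?F z) = \<rho> * \<bar>(cmod z)\<^sup>2 - 1\<bar> * (cmod (k z) / \<rho>)"
        by (simp only: norm_mult norm_divide cmod_unit_circle_intersection_poly[OF True z] z)
      also have "\<bar>(cmod z)\<^sup>2 - 1\<bar> = (cmod z + 1) * \<bar>cmod z - 1\<bar>"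
      proof -
        have "(cmod z)\<^sup>2 - 1 = (cmod z + 1) * (cmod z - 1)"
          by (simp add: power2_eq_square algebra_simps)
        then show ?thesis by (simp add: abs_mult)
      qed
      also have "\<rho> * ((cmod z + 1) * \<bar>cmod z - 1\<bar>) * (cmod (k z) / \<rho>)
          = (cmod z + 1) * (cmod (k z) * \<bar>cmod z - 1\<bar>)"
        using \<rho> by simp
      also have "\<dots> \<le> 3 * C"
      proof (intro mult_mono bound zb)
        \<comment> \<open>On this circle \<open>cmod z \<le> 1 + \<rho> < 2\<close>; this is where
          \<open>\<rho> < 1\<close> enters.\<close>
        show "cmod z + 1 \<le> 3"
          using norm_triangle_ineq[of "z - \<zeta>" \<zeta>] z \<rho> True by simp
      qed auto
      finally show ?thesis .
    qed
    moreover have "0 \<le> C"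
    proof -
      have "\<zeta> + of_real \<rho> \<in> ball \<zeta> e - {\<zeta>}" using \<rho> by (auto simp: dist_norm)
      from bound[OF this] show ?thesis
        by (meson abs_ge_zero mult_nonneg_nonneg norm_ge_zero order_trans)
    qed
    ultimately have "cmod (2 * pi * \<i> * ?r2
        + complex_of_real (\<rho>\<^sup>2) * \<zeta> * (2 * pi * \<i> * ?r1)
        + complex_of_real (\<rho>\<^sup>2) * \<zeta>\<^sup>2 * (2 * pi * \<i> * ?r0)) \<le> 3 * C * (2 * pi * \<rho>)"
      using \<rho> by (intro has_contour_integral_bound_circlepath) auto
    also have "2 * pi * \<i> * ?r2
        + complex_of_real (\<rho>\<^sup>2) * \<zeta> * (2 * pi * \<i> * ?r1)
        + complex_of_real (\<rho>\<^sup>2) * \<zeta>\<^sup>2 * (2 * pi * \<i> * ?r0)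
      = 2 * pi * \<i> * (?r2 + complex_of_real (\<rho>\<^sup>2) * \<zeta> * ?r1 + complex_of_real (\<rho>\<^sup>2) * \<zeta>\<^sup>2 * ?r0)"
      by (simp add: algebra_simps)
    finally show ?thesis by (simp add: norm_mult)
  qed
  \<comment> \<open>The three residues do not depend on \<rho>, so only \<open>?r2\<close> survives
    in the limit.\<close>
  have "((\<lambda>\<rho>. cmod (?r2 + complex_of_real (\<rho>\<^sup>2) * \<zeta> * ?r1 + complex_of_real (\<rho>\<^sup>2) * \<zeta>\<^sup>2 * ?r0))
      \<longlongrightarrow> cmod (?r2 + complex_of_real (0\<^sup>2) * \<zeta> * ?r1 + complex_of_real (0\<^sup>2) * \<zeta>\<^sup>2 * ?r0)) (at_right 0)"
    by (intro tendsto_intros)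
  moreover have "((\<lambda>\<rho>. 3 * C * \<rho>) \<longlongrightarrow> 3 * C * 0) (at_right 0)"
    by (intro tendsto_intros)
  moreover have "\<forall>\<^sub>F \<rho> in at_right 0.
      cmod (?r2 + complex_of_real (\<rho>\<^sup>2) * \<zeta> * ?r1 + complex_of_real (\<rho>\<^sup>2) * \<zeta>\<^sup>2 * ?r0) \<le> 3 * C * \<rho>"
    unfolding eventually_at_right_field using e
    by (intro exI[of _ "min e 1"] conjI allI impI est) auto
  ultimately have "cmod (?r2 + complex_of_real (0\<^sup>2) * \<zeta> * ?r1 + complex_of_real (0\<^sup>2) * \<zeta>\<^sup>2 * ?r0) \<le> 3 * C * 0"
    by (intro tendsto_le[of "at_right (0::real)"]) auto
  then show ?thesis by simp
next
  case False
  \<comment> \<open>Within distance \<open>d\<close> of \<zeta> the modulus stays at least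
    \<open>d\<close> away from 1, which bounds \<open>k\<close> by \<open>C / d\<close>.\<close>
  define d where "d = \<bar>cmod \<zeta> - 1\<bar> / 2"
  have d: "0 < d" using False by (simp add: d_def)
  have ev: "\<forall>\<^sub>F z in at \<zeta>. cmod (k z) \<le> C / d"
    unfolding eventually_at
  proof (intro exI[of _ "min d e"] conjI ballI impI)
    fix z assume z: "z \<noteq> \<zeta> \<and> dist z \<zeta> < min d e"
    have "d \<le> \<bar>cmod z - 1\<bar>"
    proof -
      have "dist z \<zeta> < d" using z by simp
      then show ?thesis
        using norm_triangle_ineq3[of z \<zeta>] unfolding d_def dist_norm by (smt (verit) field_sum_of_halves)
    qed
    then have "cmod (k z) * d \<le> cmod (k z) * \<bar>cmod z - 1\<bar>"
      by (intro mult_left_mono) auto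
    also have "\<dots> \<le> C" using z by (intro bound) (auto simp: dist_commute)
    finally show "cmod (k z) \<le> C / d" using d by (simp add: field_simps)
  qed (use d e in auto)
  \<comment> \<open>\<open>residue_simple'\<close> reads the residue off as the limit of the
    function times \<open>z - \<zeta>\<close>.\<close>
  have "((\<lambda>z. (z - \<zeta>) * k z * (z - \<zeta>)) \<longlongrightarrow> 0) (at \<zeta>)"
  proof (rule Lim_null_comparison)
    show "\<forall>\<^sub>F z in at \<zeta>. cmod ((z - \<zeta>) * k z * (z - \<zeta>)) \<le> cmod (z - \<zeta>) * (C / d) * cmod (z - \<zeta>)"
      using ev
      by eventually_elim (simp only: norm_mult, intro mult_right_mono mult_left_mono norm_ge_zero)
    have "((\<lambda>z. cmod (z - \<zeta>) * (C / d) * cmod (z - \<zeta>))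
        \<longlongrightarrow> cmod (\<zeta> - \<zeta>) * (C / d) * cmod (\<zeta> - \<zeta>)) (at \<zeta>)"
      by (intro tendsto_intros)
    then show "((\<lambda>z. cmod (z - \<zeta>) * (C / d) * cmod (z - \<zeta>)) \<longlongrightarrow> 0) (at \<zeta>)" by simp
  qed
  with e holo show ?thesis
    by (intro residue_simple'[of "ball \<zeta> e"]) (auto intro!: holomorphic_intros)
qed

text \<open>On a large circle of radius \<open>R\<close> the integral of \<open>h\<close> is 0 and
  that of \<open>c / z\<close> is \<open>2 * pi * \<i> * c\<close>. If \<open>c\<close> were
  nonzero, the two integrands would eventually differ by at most \<open>cmod c / 2 / R\<close>,
  giving \<open>2 * pi * cmod c \<le> pi * cmod c\<close>.\<close>

lemma limit_at_infinity_eq_0_if_residues_0: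
  assumes S: "finite S" and holo: "h holomorphic_on - S"
    and res: "\<And>p. p \<in> S \<Longrightarrow> residue h p = 0"
    and lim: "((\<lambda>z. z * h z) \<longlongrightarrow> c) at_infinity"
  shows "c = 0"
proof (rule ccontr)
  assume "c \<noteq> 0"
  then have "\<forall>\<^sub>F z in at_infinity. dist (z * h z) c < cmod c / 2"
    using lim by (intro tendstoD) auto
  then obtain b where b: "\<And>z. b \<le> cmod z \<Longrightarrow> dist (z * h z) c < cmod c / 2"
    by (auto simp: eventually_at_infinity)
  obtain B where B: "\<And>p. p \<in> S \<Longrightarrow> cmod p \<le> B"
    using finite_imp_bounded[OF S] by (auto simp: bounded_iff)
  \<comment> \<open>The circle encloses all of \<open>S\<close> and lies in the region where
    \<open>z * h z\<close> is close to \<open>c\<close>.\<close>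
  define R where "R = max 1 (max b (B + 1))"
  have R: "0 < R" "b \<le> R" "B < R" by (auto simp: R_def)
  let ?g = "circlepath 0 R"
  have sub: "path_image ?g \<subseteq> - S"
    using R B by fastforce
  have "contour_integral ?g h = 2 * pi * \<i> * (\<Sum>p\<in>S. winding_number ?g p * residue h p)"
    using S holo sub by (intro Residue_theorem[of UNIV]) (auto simp: Compl_eq_Diff_UNIV)
  then have "contour_integral ?g h = 0" using res by simp
  moreover have "h contour_integrable_on ?g"
    by (rule contour_integrable_holomorphic_simple[OF holo]) (use S sub in \<open>auto simp: finite_imp_closed\<close>)
  ultimately have 1: "(h has_contour_integral 0) ?g"
    using has_contour_integral_integral by fastforce
  have 2: "((\<lambda>z. c / (z - 0)) has_contour_integral 2 * pi * \<i> * c) ?g"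
    using R Cauchy_integral_circlepath_simple[of "\<lambda>_. c" 0 R 0] by simp
  have "((\<lambda>z. h z - c / (z - 0)) has_contour_integral 0 - 2 * pi * \<i> * c) ?g"
    by (rule has_contour_integral_diff[OF 1 2])
  then have "cmod (0 - 2 * pi * \<i> * c) \<le> cmod c / 2 / R * (2 * pi * R)"
  proof (rule has_contour_integral_bound_circlepath)
    fix z assume z: "cmod (z - 0) = R"
    then have "h z - c / (z - 0) = (z * h z - c) / z"
      using R by (auto simp: field_simps)
    then have "cmod (h z - c / (z - 0)) = dist (z * h z) c / R"
      using z by (simp add: norm_divide dist_norm)
    also have "\<dots> \<le> cmod c / 2 / R"
      using b[of z] z R by (intro divide_right_mono) auto
    finally show "cmod (h z - c / (z - 0)) \<le> cmod c / 2 / R" .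
  qed (use R in auto)
  then have "2 * pi * cmod c \<le> pi * cmod c" using R by (simp add: norm_mult)
  then show False using \<open>c \<noteq> 0\<close> by simp
qed

section \<open>Complex linear operators and the resolvent\<close>

lemma scaleC_zero_right [simp]: "c *\<^sub>C (0::'a::complex_normed_vector) = 0"
  using norm_scaleC[of c "0::'a"] by simp

lemma scaleC_zero_left [simp]: "0 *\<^sub>C (x::'a::complex_normed_vector) = 0"
  using norm_scaleC[of 0 x] by simp

lemma scaleC_minus_right [simp]: "c *\<^sub>C (- x) = - (c *\<^sub>C (x::'a::complex_normed_vector))"
  using scaleC_add_right[of c x "- x"] by (simp add: eq_neg_iff_add_eq_0 add.commute)

lemma scaleC_diff_right: "c *\<^sub>C (x - y) = c *\<^sub>C x - c *\<^sub>C (y::'a::complex_normed_vector)"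
  using scaleC_add_right[of c x "- y"] by simp

lemma scaleC_minus_left [simp]: "(- c) *\<^sub>C x = - (c *\<^sub>C (x::'a::complex_normed_vector))"
  using scaleC_add_left[of c "- c" x] by (simp add: eq_neg_iff_add_eq_0 add.commute)

lemma scaleC_diff_left: "(c - d) *\<^sub>C x = c *\<^sub>C x - d *\<^sub>C (x::'a::complex_normed_vector)"
  using scaleC_add_left[of c "- d" x] by simp

lemmas scaleC_algebra_simps =
  scaleC_add_right scaleC_add_left scaleC_diff_right scaleC_diff_left scaleC_scaleC scaleC_one

lemma bounded_opsD: "T \<in> bounded_ops \<Longrightarrow> blinfun_apply T (a *\<^sub>C x) = a *\<^sub>C blinfun_apply T x"
  by (simp add: bounded_ops_def)

lemma bounded_ops_id [simp]: "id_blinfun \<in> bounded_ops"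
  and bounded_ops_compose: "A \<in> bounded_ops \<Longrightarrow> B \<in> bounded_ops \<Longrightarrow> A o\<^sub>L B \<in> bounded_ops"
  and bounded_ops_diff: "A \<in> bounded_ops \<Longrightarrow> B \<in> bounded_ops \<Longrightarrow> A - B \<in> bounded_ops"
  and bounded_ops_scaleC: "A \<in> bounded_ops \<Longrightarrow> c *\<^sub>C A \<in> bounded_ops"
  by (auto simp: bounded_ops_def blinfun.add_left blinfun.diff_left scaleC_blinfun.rep_eq
      scaleC_algebra_simps mult.commute)

lemmas bounded_ops_intros =
  bounded_ops_id bounded_ops_compose bounded_ops_diff
  bounded_ops_scaleC

lemmas blinfun_algebra_simps =
  blinfun.add_left blinfun.diff_left blinfun.minus_left blinfun.add_right blinfun.diff_right
  blinfun.minus_right scaleC_blinfun.rep_eq scaleC_algebra_simps bounded_opsD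

lemmas blinfun_compose_tendsto = bounded_bilinear.tendsto[OF bounded_bilinear_blinfun_compose]
  and blinfun_compose_diff_right = bounded_bilinear.diff_right[OF bounded_bilinear_blinfun_compose]
  and blinfun_compose_sum_right = bounded_bilinear.sum_right[OF bounded_bilinear_blinfun_compose]

lemma blinfun_eq_iff: "A = B \<longleftrightarrow> (\<forall>x. blinfun_apply A x = blinfun_apply B x)"
  by (auto intro: blinfun_eqI)

lemma blinfun_compose_id [simp]: "A o\<^sub>L id_blinfun = A" "id_blinfun o\<^sub>L A = A"
  by (rule blinfun_eqI, simp)+

lemma blinfun_compose_assoc: "(A o\<^sub>L B) o\<^sub>L C = A o\<^sub>L (B o\<^sub>L C)"
  by (rule blinfun_eqI) simp

lemma is_op_inverse_op_inverse:
  assumes "op_invertible T"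
  shows "is_op_inverse T (op_inverse T)"
proof -
  obtain S where S: "is_op_inverse T S" using assms by (auto simp: op_invertible_def)
  have "S' = S" if "is_op_inverse T S'" for S'
  proof -
    have "S' o\<^sub>L (T o\<^sub>L S) = (S' o\<^sub>L T) o\<^sub>L S" by (simp add: blinfun_compose_assoc)
    then show ?thesis using S that by (simp add: is_op_inverse_def)
  qed
  then show ?thesis unfolding op_inverse_def by (rule theI[where P = "is_op_inverse T", OF S])
qed

section \<open>Bounds on powers and the Neumann expansion\<close>

lemma op_power_bound:
  assumes "power_bounded T"
  obtains C where "0 < C" "\<And>n. norm (op_power T n) \<le> C" "\<And>n. norm (op_power (op_inverse T) n) \<le> C"
proof -
  obtain M where M: "\<And>n::int. norm (op_power_int T n) \<le> M"
    using assms by (auto simp: power_bounded_def bdd_above_def)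
  have "norm (op_power T n) \<le> M" for n
    using M[of "int n"] by (simp add: op_power_int_def)
  \<comment> \<open>At \<open>n = 0\<close> the integer power falls into the nonnegative branch;
    both zeroth powers are the identity.\<close>
  moreover have "norm (op_power (op_inverse T) n) \<le> M" for n
    using M[of "- int n"] by (cases "n = 0") (simp_all add: op_power_int_def)
  ultimately show ?thesis
    using that[of "max M 1"] by (simp add: le_max_iff_disj)
qed

text \<open>The Neumann expansion of \<open>Y\<close>, with remainder \<open>w\<^sup>n A\<^sup>n Y\<close>, used in place of convergence of the
  series.\<close>

lemma norm_fixpoint_le:
  fixes A :: "'a::complex_normed_vector \<Rightarrow>\<^sub>L 'a"
  assumes A: "A \<in> bounded_ops" and Y: "Y = E + w *\<^sub>C (A o\<^sub>L Y)" and w: "cmod w < 1"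
    and C: "\<And>n. norm (op_power A n) \<le> C" and E: "\<And>n. norm (op_power A n o\<^sub>L E) \<le> D"
  shows "norm Y * (1 - cmod w) \<le> D"
proof -
  have bops: "op_power A n \<in> bounded_ops" for n
    by (induction n) (auto intro: bounded_ops_intros A)
  \<comment> \<open>Substituting the equation for \<open>Y\<close> into the remainder puts
    \<open>A\<close> to the right of the power, while \<open>op_power\<close> adds it on the
    left.\<close>
  have comm: "op_power A n o\<^sub>L A = A o\<^sub>L op_power A n" for n
    by (induction n) (auto simp: blinfun_compose_assoc)
  have iter: "Y = (\<Sum>k<n. w ^ k *\<^sub>C (op_power A k o\<^sub>L E)) + w ^ n *\<^sub>C (op_power A n o\<^sub>L Y)" for n
  proof (induction n)
    case 0
    then show ?case by (simp add: scaleC_one)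
  next
    case (Suc n)
    have "op_power A n o\<^sub>L Y = (op_power A n o\<^sub>L E) + w *\<^sub>C (op_power A n o\<^sub>L A o\<^sub>L Y)"
      by (subst Y) (rule blinfun_eqI, simp add: blinfun_algebra_simps bops A)
    then have "w ^ n *\<^sub>C (op_power A n o\<^sub>L Y)
        = w ^ n *\<^sub>C (op_power A n o\<^sub>L E) + w ^ Suc n *\<^sub>C (op_power A (Suc n) o\<^sub>L Y)"
      by (simp add: comm scaleC_algebra_simps mult.commute)
    with Suc show ?case by (simp add: add.assoc)
  qed
  have D: "0 \<le> D" using E[of 0] norm_ge_zero order_trans by blast
  \<comment> \<open>The factor \<open>1 - cmod w\<close> sums the geometric series in closed form;
    the remainder vanishes as \<open>n\<close> grows because the powers of \<open>A\<close> are
    bounded.\<close>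
  have bound: "norm Y * (1 - cmod w) \<le> D + cmod w ^ n * (C * norm Y) * (1 - cmod w)" for n
  proof -
    have "norm Y \<le> norm (\<Sum>k<n. w ^ k *\<^sub>C (op_power A k o\<^sub>L E)) + norm (w ^ n *\<^sub>C (op_power A n o\<^sub>L Y))"
      by (subst iter[of n]) (rule norm_triangle_ineq)
    also have "\<dots> \<le> (\<Sum>k<n. cmod w ^ k * D) + cmod w ^ n * (C * norm Y)"
    proof (rule add_mono)
      show "norm (\<Sum>k<n. w ^ k *\<^sub>C (op_power A k o\<^sub>L E)) \<le> (\<Sum>k<n. cmod w ^ k * D)"
        by (rule sum_norm_le) (auto simp: norm_scaleC norm_power intro!: mult_left_mono E)
      have "norm (op_power A n o\<^sub>L Y) \<le> C * norm Y"
        by (rule order_trans[OF norm_blinfun_compose]) (intro mult_right_mono C norm_ge_zero)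
      then show "norm (w ^ n *\<^sub>C (op_power A n o\<^sub>L Y)) \<le> cmod w ^ n * (C * norm Y)"
        by (auto simp: norm_scaleC norm_power intro!: mult_left_mono)
    qed
    finally have "norm Y * (1 - cmod w)
        \<le> ((\<Sum>k<n. cmod w ^ k * D) + cmod w ^ n * (C * norm Y)) * (1 - cmod w)"
      using w by (intro mult_right_mono) auto
    also have "(\<Sum>k<n. cmod w ^ k * D) * (1 - cmod w) = D * (1 - cmod w ^ n)"
      by (simp add: one_diff_power_eq flip: sum_distrib_right)
    then have "((\<Sum>k<n. cmod w ^ k * D) + cmod w ^ n * (C * norm Y)) * (1 - cmod w)
        = D * (1 - cmod w ^ n) + cmod w ^ n * (C * norm Y) * (1 - cmod w)"
      by (simp add: distrib_right)
    also have "D * (1 - cmod w ^ n) \<le> D"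
      using D w by (intro mult_left_le) auto
    finally show ?thesis by simp
  qed
  have "(\<lambda>n. D + cmod w ^ n * (C * norm Y) * (1 - cmod w)) \<longlonglongrightarrow> D + 0 * (C * norm Y) * (1 - cmod w)"
    using w by (intro tendsto_intros LIMSEQ_power_zero) auto
  then show ?thesis
    by (intro LIMSEQ_le_const) (auto intro: bound)
qed

section \<open>The resolvent: identities, holomorphy and growth\<close>

definition resolvent :: "('a::complex_normed_vector \<Rightarrow>\<^sub>L 'a) \<Rightarrow> complex \<Rightarrow> ('a \<Rightarrow>\<^sub>L 'a)" where
  "resolvent T z = op_inverse (T - z *\<^sub>C id_blinfun)"

context
  fixes T :: "'a::complex_normed_vector \<Rightarrow>\<^sub>L 'a"
  assumes T: "T \<in> bounded_ops"
begin

lemma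
  assumes "z \<notin> op_spectrum T"
  shows resolvent_bounded_ops: "resolvent T z \<in> bounded_ops"
    and compose_resolvent: "T o\<^sub>L resolvent T z = id_blinfun + z *\<^sub>C resolvent T z"
    and resolvent_compose: "resolvent T z o\<^sub>L T = id_blinfun + z *\<^sub>C resolvent T z"
proof -
  have inv: "is_op_inverse (T - z *\<^sub>C id_blinfun) (resolvent T z)"
    using assms by (simp add: op_spectrum_def resolvent_def is_op_inverse_op_inverse)
  then show bo: "resolvent T z \<in> bounded_ops" by (simp add: is_op_inverse_def)
  have "(T - z *\<^sub>C id_blinfun) o\<^sub>L resolvent T z = (T o\<^sub>L resolvent T z) - z *\<^sub>C resolvent T z"
    by (rule blinfun_eqI) (simp add: blinfun_algebra_simps T)
  with inv show "T o\<^sub>L resolvent T z = id_blinfun + z *\<^sub>C resolvent T z"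
    by (simp add: is_op_inverse_def algebra_simps)
  have "resolvent T z o\<^sub>L (T - z *\<^sub>C id_blinfun) = (resolvent T z o\<^sub>L T) - z *\<^sub>C resolvent T z"
    by (rule blinfun_eqI) (simp add: blinfun_algebra_simps bo)
  with inv show "resolvent T z o\<^sub>L T = id_blinfun + z *\<^sub>C resolvent T z"
    by (simp add: is_op_inverse_def algebra_simps)
qed

text \<open>The product R(z) T R(w) is computed in two ways, letting \<open>T\<close> be absorbed by
  either resolvent.\<close>

lemma resolvent_identity:
  assumes z: "z \<notin> op_spectrum T" and w: "w \<notin> op_spectrum T"
  shows "resolvent T z - resolvent T w = (z - w) *\<^sub>C (resolvent T z o\<^sub>L resolvent T w)"
proof -
  have "resolvent T z o\<^sub>L (T o\<^sub>L resolvent T w) = resolvent T z o\<^sub>L T o\<^sub>L resolvent T w"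
    by (simp add: blinfun_compose_assoc)
  then have "resolvent T z o\<^sub>L (id_blinfun + w *\<^sub>C resolvent T w)
      = (id_blinfun + z *\<^sub>C resolvent T z) o\<^sub>L resolvent T w"
    using assms by (simp add: compose_resolvent resolvent_compose)
  then have "resolvent T z + w *\<^sub>C (resolvent T z o\<^sub>L resolvent T w)
      = resolvent T w + z *\<^sub>C (resolvent T z o\<^sub>L resolvent T w)"
    by (auto simp: blinfun_eq_iff blinfun_algebra_simps resolvent_bounded_ops[OF z])
  then show ?thesis by (simp add: scaleC_diff_left algebra_simps)
qed

text \<open>The resolvent identity bounds the difference by
  \<open>cmod (z - w) * norm (resolvent T z) * M\<close>. Once
  \<open>cmod (z - w) * M \<le> 1 / 2\<close>, this is at most half of
  \<open>norm (resolvent T z)\<close>, so that norm is at most \<open>2 * M\<close>, and the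
  difference is O(\<open>cmod (z - w)\<close>).\<close>

lemma tendsto_resolvent:
  assumes op: "open (- op_spectrum T)" and w: "w \<notin> op_spectrum T"
  shows "(resolvent T \<longlongrightarrow> resolvent T w) (at w)"
proof -
  define M where "M = norm (resolvent T w) + 1"
  have M: "0 < M" "norm (resolvent T w) \<le> M"
    by (auto simp: M_def intro: add_nonneg_pos)
  have le: "norm (resolvent T z - resolvent T w) \<le> cmod (z - w) * norm (resolvent T z) * M"
    if z: "z \<notin> op_spectrum T" for z
  proof -
    have "norm (resolvent T z o\<^sub>L resolvent T w) \<le> norm (resolvent T z) * M"
      by (rule order_trans[OF norm_blinfun_compose]) (intro mult_left_mono M norm_ge_zero)
    then show ?thesis
      by (simp add: resolvent_identity[OF z w] norm_scaleC mult.assoc mult_left_mono)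
  qed
  have ev: "\<forall>\<^sub>F z in at w. z \<in> - op_spectrum T"
    using op w by (intro eventually_at_in_open') auto
  have ev': "\<forall>\<^sub>F z in at w. dist z w < 1 / (2 * M)"
    using M by (intro eventually_at_ball[of "1 / (2 * M)", THEN eventually_mono]) (auto simp: dist_commute)
  have "((\<lambda>z. resolvent T z - resolvent T w) \<longlongrightarrow> 0) (at w)"
  proof (rule Lim_null_comparison)
    show "\<forall>\<^sub>F z in at w. norm (resolvent T z - resolvent T w) \<le> cmod (z - w) * (2 * M) * M"
      using ev ev'
    proof eventually_elim
      case (elim z)
      have "cmod (z - w) * M \<le> 1 / 2"
        using elim M by (simp add: dist_norm field_simps)
      then have "cmod (z - w) * M * norm (resolvent T z) \<le> 1 / 2 * norm (resolvent T z)"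
        by (rule mult_right_mono) simp
      then have "norm (resolvent T z) \<le> 2 * M"
        using le[of z] elim M norm_triangle_ineq[of "resolvent T z - resolvent T w" "resolvent T w"]
        by (simp add: mult_ac)
      then have "cmod (z - w) * norm (resolvent T z) * M \<le> cmod (z - w) * (2 * M) * M"
        using M by (intro mult_right_mono mult_left_mono) auto
      with le[of z] elim show ?case by simp
    qed
    have "((\<lambda>z. cmod (z - w) * (2 * M) * M) \<longlongrightarrow> cmod (w - w) * (2 * M) * M) (at w)"
      by (intro tendsto_intros)
    then show "((\<lambda>z. cmod (z - w) * (2 * M) * M) \<longlongrightarrow> 0) (at w)" by simp
  qed
  then show ?thesis by (simp only: LIM_zero_iff)
qed

text \<open>By the resolvent identity the difference quotient at \<open>w\<close> is f(A R(z) R(w)),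
  which by continuity of the resolvent tends to f(A R(w) R(w)).\<close>

lemma holomorphic_functional_resolvent:
  fixes f :: "('a \<Rightarrow>\<^sub>L 'a) \<Rightarrow> complex"
  assumes op: "open (- op_spectrum T)" and A: "A \<in> bounded_ops"
    and f: "bounded_linear f" "\<And>c x. f (c *\<^sub>C x) = c * f x"
  shows "(\<lambda>z. f (A o\<^sub>L resolvent T z)) holomorphic_on - op_spectrum T"
  unfolding holomorphic_on_open[OF op]
proof
  interpret f: bounded_linear f by fact
  fix w assume w: "w \<in> - op_spectrum T"
  have "((\<lambda>z. f (A o\<^sub>L (resolvent T z o\<^sub>L resolvent T w)))
      \<longlongrightarrow> f (A o\<^sub>L (resolvent T w o\<^sub>L resolvent T w))) (at w)"
    using w op by (intro f.tendsto blinfun_compose_tendsto tendsto_const tendsto_resolvent) auto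
  moreover have "\<forall>\<^sub>F z in at w. f (A o\<^sub>L (resolvent T z o\<^sub>L resolvent T w))
      = (f (A o\<^sub>L resolvent T z) - f (A o\<^sub>L resolvent T w)) / (z - w)"
    using eventually_at_in_open'[OF op w] eventually_neq_at_within[of w w UNIV]
  proof eventually_elim
    case (elim z)
    have "(A o\<^sub>L resolvent T z) - (A o\<^sub>L resolvent T w) = A o\<^sub>L (resolvent T z - resolvent T w)"
      by (simp add: blinfun_compose_diff_right)
    also have "\<dots> = (z - w) *\<^sub>C (A o\<^sub>L (resolvent T z o\<^sub>L resolvent T w))"
      using elim w by (subst resolvent_identity)
        (auto simp: blinfun_eq_iff blinfun_algebra_simps A)
    finally have "f (A o\<^sub>L resolvent T z) - f (A o\<^sub>L resolvent T w)
        = (z - w) * f (A o\<^sub>L (resolvent T z o\<^sub>L resolvent T w))"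
      by (simp add: f(2) flip: f.diff)
    with elim show ?case by simp
  qed
  ultimately have "((\<lambda>z. f (A o\<^sub>L resolvent T z)) has_field_derivative
      f (A o\<^sub>L (resolvent T w o\<^sub>L resolvent T w))) (at w)"
    unfolding has_field_derivative_iff by (rule Lim_transform_eventually)
  then show "\<exists>f'. ((\<lambda>z. f (A o\<^sub>L resolvent T z)) has_field_derivative f') (at w)"
    by blast
qed

text \<open>Outside the unit disc R(z) is expanded in powers of \<open>T\<close>, inside it in
  powers of the inverse; both families are bounded. On the unit circle the left side is 0.\<close>

lemma resolvent_bound:
  assumes pb: "power_bounded T"
  obtains C where "0 < C"
    "\<And>z. z \<notin> op_spectrum T \<Longrightarrow> norm (resolvent T z) * \<bar>cmod z - 1\<bar> \<le> C"
proof -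
  obtain C where C: "0 < C" "\<And>n. norm (op_power T n) \<le> C" "\<And>n. norm (op_power (op_inverse T) n) \<le> C"
    using op_power_bound[OF pb] by blast
  let ?V = "op_inverse T"
  have V: "?V \<in> bounded_ops" "?V o\<^sub>L T = id_blinfun"
    using is_op_inverse_op_inverse[of T] pb by (auto simp: power_bounded_def is_op_inverse_def)
  have "norm (resolvent T z) * \<bar>cmod z - 1\<bar> \<le> C" if z: "z \<notin> op_spectrum T" for z
  proof -
    consider "cmod z > 1" | "cmod z = 1" | "cmod z < 1" by linarith
    then show ?thesis
    proof cases
      case 1
      then have z0: "z \<noteq> 0" by auto
      have "norm (resolvent T z) * (1 - cmod (inverse z)) \<le> C / cmod z"
      \<comment> \<open>Here \<open>E\<close> is \<open>- inverse z\<close> times the identity,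
        which accounts for the bound \<open>C / cmod z\<close>; the division by
        \<open>cmod z\<close> cancels afterwards.\<close>
      proof (rule norm_fixpoint_le[OF T _ _ C(2)])
        show "resolvent T z = - (inverse z *\<^sub>C id_blinfun) + inverse z *\<^sub>C (T o\<^sub>L resolvent T z)"
          using z0 by (simp add: compose_resolvent[OF z] scaleC_algebra_simps)
        show "cmod (inverse z) < 1" using 1 by (simp add: norm_inverse inverse_less_1_iff)
        fix n
        have "op_power T n \<in> bounded_ops"
          by (induction n) (auto intro: bounded_ops_intros T)
        then have "op_power T n o\<^sub>L - (inverse z *\<^sub>C id_blinfun) = - (inverse z *\<^sub>C op_power T n)"
          by (auto simp: blinfun_eq_iff blinfun_algebra_simps)
        then show "norm (op_power T n o\<^sub>L - (inverse z *\<^sub>C id_blinfun)) \<le> C / cmod z"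
          using C(2)[of n] z0 by (simp add: norm_scaleC norm_inverse divide_inverse mult.commute mult_left_mono)
      qed
      also have "norm (resolvent T z) * (1 - cmod (inverse z))
          = norm (resolvent T z) * (cmod z - 1) / cmod z"
      proof -
        have "cmod z \<noteq> 0" using z0 by simp
        then show ?thesis unfolding norm_inverse by (simp add: field_simps del: norm_eq_zero)
      qed
      finally show ?thesis using 1 z0 by (simp add: divide_le_cancel)
    next
      case 3
      have "norm (resolvent T z) * (1 - cmod z) \<le> C"
      \<comment> \<open>With both \<open>A\<close> and \<open>E\<close> equal to \<open>?V\<close>,
        the product of \<open>A^n\<close> and \<open>E\<close> is again a power of
        \<open>?V\<close>, so \<open>D\<close> is \<open>C\<close> itself.\<close>
      proof (rule norm_fixpoint_le[OF V(1) _ 3 C(3)])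
        have "resolvent T z = ?V o\<^sub>L T o\<^sub>L resolvent T z" by (simp add: V)
        also have "\<dots> = ?V o\<^sub>L (T o\<^sub>L resolvent T z)" by (simp add: blinfun_compose_assoc)
        also have "\<dots> = ?V + z *\<^sub>C (?V o\<^sub>L resolvent T z)"
          unfolding compose_resolvent[OF z]
          by (rule blinfun_eqI) (simp add: blinfun_algebra_simps V)
        finally show "resolvent T z = ?V + z *\<^sub>C (?V o\<^sub>L resolvent T z)" .
        fix n
        have "op_power ?V n o\<^sub>L ?V = op_power ?V (Suc n)"
          by (induction n) (auto simp: blinfun_compose_assoc)
        then show "norm (op_power ?V n o\<^sub>L ?V) \<le> C" using C(3)[of "Suc n"] by simp
      qed
      then show ?thesis using 3 by simp
    qed (use C in simp)
  qed
  with C(1) show ?thesis using that by blast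
qed

text \<open>The factor \<open>T - p\<close> stands on the right of \<open>P\<close>, next to the
  resolvent, where it turns R(z) into I + (z - p) R(z). The cofactor \<open>B\<close> may depend on
  \<open>p\<close>, since each residue is treated separately.\<close>

lemma eq_0_if_factors_at_spectrum:
  assumes pb: "power_bounded T" and fin: "finite (op_spectrum T)" and P: "P \<in> bounded_ops"
    and factor: "\<And>p. p \<in> op_spectrum T \<Longrightarrow>
      \<exists>B\<in>bounded_ops. P = B o\<^sub>L (T - p *\<^sub>C id_blinfun)"
  shows "P = 0"
proof (rule ccontr)
  assume "P \<noteq> 0"
  then obtain f :: "('a \<Rightarrow>\<^sub>L 'a) \<Rightarrow> complex"
    where f: "bounded_linear f" "\<And>c x. f (c *\<^sub>C x) = c * f x" "f P \<noteq> 0"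
    using exists_bounded_complex_functional by blast
  interpret f: bounded_linear f by fact
  obtain K where K: "0 \<le> K" "\<And>x. norm (f x) \<le> norm x * K"
    using f.nonneg_bounded by blast
  obtain C where C: "0 < C" "\<And>z. z \<notin> op_spectrum T \<Longrightarrow> norm (resolvent T z) * \<bar>cmod z - 1\<bar> \<le> C"
    using resolvent_bound[OF pb] by blast
  have op: "open (- op_spectrum T)" using fin by (simp add: finite_imp_closed open_Compl)
  note holo = holomorphic_functional_resolvent[OF op _ f(1,2)]
  have bound: "cmod (f (A o\<^sub>L resolvent T z)) * \<bar>cmod z - 1\<bar> \<le> norm A * K * C"
    if z: "z \<notin> op_spectrum T" for A z
  proof -
    have "cmod (f (A o\<^sub>L resolvent T z)) \<le> norm A * norm (resolvent T z) * K"
      using K order_trans[OF K(2) mult_right_mono[OF norm_blinfun_compose]] by blast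
    then have "cmod (f (A o\<^sub>L resolvent T z)) * \<bar>cmod z - 1\<bar>
        \<le> norm A * norm (resolvent T z) * K * \<bar>cmod z - 1\<bar>"
      by (rule mult_right_mono) simp
    also have "\<dots> = norm A * K * (norm (resolvent T z) * \<bar>cmod z - 1\<bar>)" by simp
    also have "\<dots> \<le> norm A * K * C" using K(1) C(2)[OF z] by (intro mult_left_mono) auto
    finally show ?thesis .
  qed
  have "- f P = 0"
  proof (rule limit_at_infinity_eq_0_if_residues_0[OF fin holo[OF P]])
    fix p assume p: "p \<in> op_spectrum T"
    obtain B where B: "B \<in> bounded_ops" "P = B o\<^sub>L (T - p *\<^sub>C id_blinfun)"
      using factor[OF p] by blast
    obtain e where e: "0 < e" "ball p e \<inter> op_spectrum T \<subseteq> {p}"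
    proof -
      have "open (- (op_spectrum T - {p}))"
        by (intro open_Compl finite_imp_closed finite_Diff fin)
      then obtain e where "0 < e" "ball p e \<subseteq> - (op_spectrum T - {p})"
        using open_contains_ball by (metis ComplI DiffD2 singletonI)
      with that show ?thesis by blast
    qed
    let ?k = "\<lambda>z. f (B o\<^sub>L resolvent T z)"
    have sub: "ball p e - {p} \<subseteq> - op_spectrum T" using e by blast
    have holok: "?k holomorphic_on ball p e - {p}"
      using holo[OF B(1)] sub by (rule holomorphic_on_subset)
    \<comment> \<open>The summand \<open>f B\<close> is constant and has no residue; the other one
      has the form handled by \<open>residue_times_diff_eq_0\<close>.\<close>
    have eq: "f (P o\<^sub>L resolvent T z) = f B + (z - p) * ?k z" if z: "z \<notin> op_spectrum T" for z
    proof -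
      have "(T - p *\<^sub>C id_blinfun) o\<^sub>L resolvent T z = (T o\<^sub>L resolvent T z) - p *\<^sub>C resolvent T z"
        by (rule blinfun_eqI) (simp add: blinfun_algebra_simps)
      also have "\<dots> = id_blinfun + (z - p) *\<^sub>C resolvent T z"
        by (simp add: compose_resolvent[OF z] scaleC_diff_left)
      finally have "P o\<^sub>L resolvent T z = B o\<^sub>L (id_blinfun + (z - p) *\<^sub>C resolvent T z)"
        by (simp add: B(2) blinfun_compose_assoc)
      also have "\<dots> = B + (z - p) *\<^sub>C (B o\<^sub>L resolvent T z)"
        by (rule blinfun_eqI) (simp add: blinfun_algebra_simps B(1))
      finally show ?thesis by (simp add: f.add f(2))
    qed
    have "residue (\<lambda>z. f (P o\<^sub>L resolvent T z)) p = residue (\<lambda>z. f B + (z - p) * ?k z) p"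
    proof (rule residue_cong)
      have "\<forall>\<^sub>F z in at p. z \<in> ball p e - {p}"
        using e by (intro eventually_at_in_open) auto
      then show "\<forall>\<^sub>F z in at p. f (P o\<^sub>L resolvent T z) = f B + (z - p) * ?k z"
        by eventually_elim (use sub eq in blast)
    qed simp
    also have "\<dots> = residue (\<lambda>z. f B) p + residue (\<lambda>z. (z - p) * ?k z) p"
      using e by (intro residue_add[of "ball p e"]) (auto intro!: holomorphic_intros holok)
    also have "residue (\<lambda>z. (z - p) * ?k z) p = 0"
      using sub by (intro residue_times_diff_eq_0[OF e(1) holok, of "norm B * K * C"] bound) auto
    finally show "residue (\<lambda>z. f (P o\<^sub>L resolvent T z)) p = 0" by (simp add: residue_const)
  next
    \<comment> \<open>The error \<open>z * f (P R(z)) + f P\<close> equals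
      \<open>f (P T R(z))\<close>, to which the growth bound applies with \<open>P T\<close> in
      place of \<open>A\<close>.\<close>
    let ?D = "norm (P o\<^sub>L T) * K * C"
    obtain b where b: "\<And>p. p \<in> op_spectrum T \<Longrightarrow> cmod p \<le> b"
      using finite_imp_bounded[OF fin] by (auto simp: bounded_iff)
    have "((\<lambda>z. z * f (P o\<^sub>L resolvent T z) - (- f P)) \<longlongrightarrow> 0) at_infinity"
    proof (rule Lim_null_comparison)
      show "\<forall>\<^sub>F z in at_infinity. norm (z * f (P o\<^sub>L resolvent T z) - (- f P)) \<le> ?D / (cmod z - 1)"
        unfolding eventually_at_infinity
      \<comment> \<open>\<open>b + 1\<close> keeps \<open>z\<close> off the spectrum, and 2 makes
        \<open>cmod z - 1\<close> positive.\<close>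
      proof (intro exI[of _ "max (b + 1) 2"] allI impI)
        fix z assume z: "max (b + 1) 2 \<le> cmod z"
        then have zs: "z \<notin> op_spectrum T" using b by fastforce
        have "P o\<^sub>L T o\<^sub>L resolvent T z = P o\<^sub>L (T o\<^sub>L resolvent T z)"
          by (simp add: blinfun_compose_assoc)
        also have "\<dots> = P + z *\<^sub>C (P o\<^sub>L resolvent T z)"
          unfolding compose_resolvent[OF zs]
          by (rule blinfun_eqI) (simp add: blinfun_algebra_simps P)
        finally have "f (P o\<^sub>L T o\<^sub>L resolvent T z) = z * f (P o\<^sub>L resolvent T z) - (- f P)"
          by (simp add: f.add f(2))
        with bound[OF zs, of "P o\<^sub>L T"] z
        show "norm (z * f (P o\<^sub>L resolvent T z) - (- f P)) \<le> ?D / (cmod z - 1)"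
          by (simp add: field_simps)
      qed
      have "filterlim (\<lambda>z::complex. - 1 + norm z) at_top at_infinity"
        by (intro filterlim_tendsto_add_at_top[OF tendsto_const] filterlim_norm_at_top)
      then show "((\<lambda>z::complex. ?D / (cmod z - 1)) \<longlongrightarrow> 0) at_infinity"
        by (intro real_tendsto_divide_at_top[OF tendsto_const]) simp
    qed
    then show "((\<lambda>z. z * f (P o\<^sub>L resolvent T z)) \<longlongrightarrow> - f P) at_infinity"
      by (simp only: LIM_zero_iff)
  qed
  with f(3) show False by simp
qed

section \<open>Products of linear factors and polynomials in \<open>T\<close>\<close>

lemma op_prod_list_bounded_ops:
  "op_prod_list (map (\<lambda>c. T - c *\<^sub>C id_blinfun) cs) \<in> bounded_ops"
  by (induction cs) (auto simp: op_prod_list_def intro!: bounded_ops_intros T)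

text \<open>The factors commute with each other, so any one of them can be moved to the right end,
  as \<open>eq_0_if_factors_at_spectrum\<close> requires.\<close>

lemma op_prod_list_factor:
  assumes "c \<in> set cs"
  shows "\<exists>B\<in>bounded_ops. op_prod_list (map (\<lambda>c. T - c *\<^sub>C id_blinfun) cs)
    = B o\<^sub>L (T - c *\<^sub>C id_blinfun)"
proof -
  define L where "L c = T - c *\<^sub>C id_blinfun" for c
  define P where "P cs = op_prod_list (map L cs)" for cs
  have L: "L c \<in> bounded_ops" for c unfolding L_def by (intro bounded_ops_intros T)
  have P_bounded: "P cs \<in> bounded_ops" for cs
    unfolding P_def L_def[abs_def] by (rule op_prod_list_bounded_ops)
  have P_Nil: "P [] = id_blinfun" and P_Cons: "P (a # cs) = L a o\<^sub>L P cs" for a cs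
    by (simp_all add: P_def op_prod_list_def)
  have swap: "L a o\<^sub>L L b = L b o\<^sub>L L a" for a b
    unfolding L_def by (rule blinfun_eqI) (simp add: blinfun_algebra_simps T mult.commute)
  have comm: "L a o\<^sub>L P cs = P cs o\<^sub>L L a" for a cs
  proof (induction cs)
    case (Cons b cs)
    have "L a o\<^sub>L P (b # cs) = (L a o\<^sub>L L b) o\<^sub>L P cs"
      by (simp only: blinfun_compose_assoc P_Cons)
    also have "\<dots> = L b o\<^sub>L (L a o\<^sub>L P cs)" by (simp only: swap[of a b] blinfun_compose_assoc)
    also have "\<dots> = P (b # cs) o\<^sub>L L a"
      by (simp only: Cons.IH blinfun_compose_assoc P_Cons)
    finally show ?case .
  qed (simp add: P_Nil)
  have "\<exists>B\<in>bounded_ops. P cs = B o\<^sub>L L c" using assms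
  proof (induction cs)
    case (Cons a cs)
    show ?case
    proof (cases "c = a")
      case True
      then have "P (a # cs) = P cs o\<^sub>L L c" by (simp only: P_Cons comm)
      with P_bounded show ?thesis by blast
    next
      case False
      with Cons obtain B where "B \<in> bounded_ops" "P cs = B o\<^sub>L L c" by auto
      then have "P (a # cs) = (L a o\<^sub>L B) o\<^sub>L L c" "L a o\<^sub>L B \<in> bounded_ops"
        by (simp_all only: P_Cons blinfun_compose_assoc bounded_ops_compose L)
      then show ?thesis by blast
    qed
  qed simp
  then show ?thesis by (simp only: P_def L_def[abs_def])
qed

text \<open>Padding with zero coefficients lets polynomials of different degrees be compared over
  one index range.\<close>

lemma poly_op_eq_sum:
  fixes S :: "'a \<Rightarrow>\<^sub>L 'a"
  assumes "degree p \<le> n"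
  shows "poly_op p S = (\<Sum>i\<le>n. coeff p i *\<^sub>C op_power S i)"
  unfolding poly_op_def using assms
  by (intro sum.mono_neutral_left) (auto simp: coeff_eq_0)

lemma poly_op_linear_factor:
  "poly_op ([:- c, 1:] * q) T = (T - c *\<^sub>C id_blinfun) o\<^sub>L poly_op q T"
proof -
  define n where "n = degree q"
  have "degree ([:- c, 1:] * q) \<le> Suc n"
    using degree_mult_le[of "[:- c, 1:]" q] by (simp add: n_def)
  \<comment> \<open>\<open>coeff (pCons 0 q) i\<close> is the coefficient of \<open>q\<close> at
    \<open>i - 1\<close>, and 0 at \<open>i = 0\<close>; shifting the index of that sum produces the
    factor \<open>T\<close>.\<close>
  then have "poly_op ([:- c, 1:] * q) T
      = (\<Sum>i\<le>Suc n. (coeff (pCons 0 q) i - c * coeff q i) *\<^sub>C op_power T i)"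
    by (simp add: poly_op_eq_sum)
  also have "\<dots> = (\<Sum>i\<le>Suc n. coeff (pCons 0 q) i *\<^sub>C op_power T i)
      - (\<Sum>i\<le>Suc n. (c * coeff q i) *\<^sub>C op_power T i)"
    by (simp only: scaleC_diff_left sum_subtractf)
  also have "(\<Sum>i\<le>Suc n. coeff (pCons 0 q) i *\<^sub>C op_power T i)
      = (\<Sum>i\<le>n. coeff q i *\<^sub>C (T o\<^sub>L op_power T i))"
    by (subst sum.atMost_Suc_shift) simp
  also have "\<dots> = T o\<^sub>L poly_op q T"
  proof -
    have "T o\<^sub>L (d *\<^sub>C S) = d *\<^sub>C (T o\<^sub>L S)" for d and S :: "'a \<Rightarrow>\<^sub>L 'a"
      by (rule blinfun_eqI) (simp add: blinfun_algebra_simps T)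
    then show ?thesis by (simp add: poly_op_def n_def blinfun_compose_sum_right)
  qed
  also have "(\<Sum>i\<le>Suc n. (c * coeff q i) *\<^sub>C op_power T i) = c *\<^sub>C poly_op q T"
  proof -
    have add: "c *\<^sub>C (\<Sum>i\<le>k. g i) = (\<Sum>i\<le>k. c *\<^sub>C g i)" for g :: "nat \<Rightarrow> 'a \<Rightarrow>\<^sub>L 'a" and k
      by (induction k) (auto simp: scaleC_add_right)
    show ?thesis
      by (subst poly_op_eq_sum[of q "Suc n"]) (simp_all only: add scaleC_scaleC n_def le_SucI order_refl)
  qed
  also have "(T o\<^sub>L poly_op q T) - c *\<^sub>C poly_op q T = (T - c *\<^sub>C id_blinfun) o\<^sub>L poly_op q T"
    by (rule blinfun_eqI) (simp add: blinfun_algebra_simps)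
  finally show ?thesis .
qed

text \<open>This exhibits the operator product as a polynomial in \<open>T\<close>, so that its
  vanishing makes \<open>T\<close> algebraic.\<close>

lemma poly_op_prod_linear_factors:
  "poly_op (\<Prod>c\<leftarrow>cs. [:- c, 1:]) T = op_prod_list (map (\<lambda>c. T - c *\<^sub>C id_blinfun) cs)"
proof (induction cs)
  case Nil
  then show ?case by (simp add: poly_op_def op_prod_list_def scaleC_one)
next
  case (Cons c cs)
  then show ?case
    by (simp only: list.map prod_list.Cons poly_op_linear_factor) (simp add: op_prod_list_def)
qed

end

theorem corollary3p5:
  fixes T :: "'a::complex_banach \<Rightarrow>\<^sub>L 'a"
    and \<mu> :: "nat \<Rightarrow> complex"
    and m :: nat
  assumes "T \<in> bounded_ops"
    and "power_bounded T"
    and "inj_on \<mu> {1..m}"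
    and "op_spectrum T = \<mu> ` {1..m}"
  shows "algebraic_op T \<and>
    op_prod_list (map (\<lambda>j. T - \<mu> j *\<^sub>C id_blinfun) [1..<Suc m]) = 0"
proof -
  let ?cs = "map \<mu> [1..<Suc m]"
  let ?P = "op_prod_list (map (\<lambda>c. T - c *\<^sub>C id_blinfun) ?cs)"
  have spec: "op_spectrum T = set ?cs"
    using assms(4) by (simp only: set_map set_upt atLeastLessThanSuc_atLeastAtMost)
  have P: "?P = 0"
  proof (rule eq_0_if_factors_at_spectrum[OF assms(1,2)])
    show "finite (op_spectrum T)" by (simp only: spec finite_set)
    show "?P \<in> bounded_ops" by (rule op_prod_list_bounded_ops[OF assms(1)])
    show "\<exists>B\<in>bounded_ops. ?P = B o\<^sub>L (T - p *\<^sub>C id_blinfun)" if "p \<in> op_spectrum T" for p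
      using that unfolding spec by (rule op_prod_list_factor[OF assms(1)])
  qed
  then have "poly_op (\<Prod>c\<leftarrow>?cs. [:- c, 1:]) T = 0"
    by (simp only: poly_op_prod_linear_factors[OF assms(1)])
  \<comment> \<open>A product of polynomials is zero only if a factor is, and each factor has
    leading coefficient 1.\<close>
  moreover have "(\<Prod>c\<leftarrow>?cs. [:- c, 1:]) \<noteq> 0"
    by (auto simp: prod_list_zero_iff)
  ultimately have "algebraic_op T" unfolding algebraic_op_def by blast
  with P show ?thesis by (simp only: map_map o_def simp_thms)
qed

end
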